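(* Let $(X,p,E)$ be a lattice-normed Riesz space and let $B$ be a band in $X$. If $(b_n)$ is a sequence in $B$ that is statistically unbounded $p$-convergent to some $x\in X$, then $x\in B$.
   Context: All Riesz spaces (vector lattices) are real and Archimedean; sequences are indexed by the positive integers $\mathbb{N}$; $E_+$ and $X_+$ denote positive cones. A band is an order closed ideal (an ideal being a solid vector subspace). A lattice-normed Riesz space $(X,p,E)$ consists of Riesz spaces $X$ and $E$ and a map $p:X\to E_+$ with $p(x)=0\Leftrightarrow x=0$, $p(\lambda x)=|\lambda|p(x)$ for $\lambda\in\mathbb{R}$, $p(x+y)\le p(x)+p(y)$, which is monotone: $|x|\le|y|$ implies $p(x)\le p(y)$. The natural density of $K\subseteq\mathbb{N}$ is $\delta(K)=\lim_{n}\frac1n|\{k\le n:k\in K\}|$. A sequence $(q_n)$ in $E$ is statistically order decreasing to $0$, written $q_n\downarrow^{st}0$, if there is $K\subseteq\mathbb{N}$ with $\delta(K)=1$ such that $(q_k)_{k\in K}$ is decreasing and $\inf_{k\in K}q_k=0$. A sequence $(x_n)$ in $X$ is statistically unbounded $p$-convergent ($st$-$up$-convergent) to $x\in X$ if for every $u\in X_+$ there exist a sequence $q_n\downarrow^{st}0$ in $E$ and a set $K\subseteq\mathbb{N}$ with $\delta(K)=1$ such that $p(|x_k-x|\wedge u)\le q_k$ for all $k\in K$. *)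

theory Defs
  imports Complex_Main "HOL-Library.Lattice_Algebras" "HOL-Library.Lub_Glb"
begin

class archimedean_riesz_space = ordered_real_vector + lattice_ab_group_add_abs +
  assumes riesz_archimedean: "(\<And>n::nat. scaleR (real n) x \<le> y) \<Longrightarrow> x \<le> 0"

locale lattice_normed_riesz_space =
  fixes p :: "'a::archimedean_riesz_space \<Rightarrow> 'b::archimedean_riesz_space"
  assumes p_nonneg: "0 \<le> p x"
    and p_eq_0_iff: "p x = 0 \<longleftrightarrow> x = 0"
    and p_scaleR: "p (c *\<^sub>R x) = \<bar>c\<bar> *\<^sub>R p x"
    and p_triangle: "p (x + y) \<le> p x + p y"
    and p_mono: "\<bar>x\<bar> \<le> \<bar>y\<bar> \<Longrightarrow> p x \<le> p y"

definition solid :: "'a::archimedean_riesz_space set \<Rightarrow> bool"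
  where "solid A \<longleftrightarrow> (\<forall>x y. y \<in> A \<and> \<bar>x\<bar> \<le> \<bar>y\<bar> \<longrightarrow> x \<in> A)"

definition riesz_ideal :: "'a::archimedean_riesz_space set \<Rightarrow> bool"
  where "riesz_ideal A \<longleftrightarrow> subspace A \<and> solid A"

text \<open>Nets are functions on a nonempty set \<open>I\<close> that is upward directed by a preorder \<open>le\<close>.\<close>

definition directed_set :: "'i set \<Rightarrow> ('i \<Rightarrow> 'i \<Rightarrow> bool) \<Rightarrow> bool"
  where "directed_set I le \<longleftrightarrow> I \<noteq> {} \<and> (\<forall>i\<in>I. le i i) \<and>
     (\<forall>i\<in>I. \<forall>j\<in>I. \<forall>k\<in>I. le i j \<and> le j k \<longrightarrow> le i k) \<and>
     (\<forall>i\<in>I. \<forall>j\<in>I. \<exists>k\<in>I. le i k \<and> le j k)"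

definition net_decreasing_to_0 ::
  "'i set \<Rightarrow> ('i \<Rightarrow> 'i \<Rightarrow> bool) \<Rightarrow> ('i \<Rightarrow> 'a::archimedean_riesz_space) \<Rightarrow> bool"
  where "net_decreasing_to_0 I le y \<longleftrightarrow>
     (\<forall>i\<in>I. \<forall>j\<in>I. le i j \<longrightarrow> y j \<le> y i) \<and> isGlb UNIV (y ` I) 0"

definition order_convergent ::
  "'i set \<Rightarrow> ('i \<Rightarrow> 'i \<Rightarrow> bool) \<Rightarrow> ('i \<Rightarrow> 'a::archimedean_riesz_space) \<Rightarrow> 'a \<Rightarrow> bool"
  where "order_convergent I le x l \<longleftrightarrow>
     (\<exists>y. net_decreasing_to_0 I le y \<and> (\<forall>i\<in>I. \<bar>x i - l\<bar> \<le> y i))"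

text \<open>A definition cannot quantify over all index types. Index sets inside the space itself suffice:
  \<open>order_closed_general_net\<close> below recovers closure under nets over arbitrary index types,
  also when the dominating net has an index set of its own.\<close>

definition order_closed :: "'a::archimedean_riesz_space set \<Rightarrow> bool"
  where "order_closed A \<longleftrightarrow>
     (\<forall>(I :: 'a set) le x l. directed_set I le \<and> (\<forall>i\<in>I. x i \<in> A) \<and> order_convergent I le x l
        \<longrightarrow> l \<in> A)"

definition band :: "'a::archimedean_riesz_space set \<Rightarrow> bool"
  where "band B \<longleftrightarrow> riesz_ideal B \<and> order_closed B"

lemma order_closed_general_net:
  fixes x :: "'i \<Rightarrow> 'a::archimedean_riesz_space" and y :: "'j \<Rightarrow> 'a"
  assumes A: "order_closed A"
    and I: "directed_set I le" and J: "directed_set J le'"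
    and x: "\<forall>i\<in>I. x i \<in> A"
    and y: "net_decreasing_to_0 J le' y"
    and dom: "\<forall>j\<in>J. \<exists>i0\<in>I. \<forall>i\<in>I. le i0 i \<longrightarrow> \<bar>x i - l\<bar> \<le> y j"
  shows "l \<in> A"
proof -
  define z where "z d = (SOME v. v \<in> A \<and> \<bar>v - l\<bar> \<le> d)" for d
  have z: "z d \<in> A \<and> \<bar>z d - l\<bar> \<le> d" if "d \<in> y ` J" for d
  proof -
    obtain j where j: "j \<in> J" "d = y j" using \<open>d \<in> y ` J\<close> by (rule imageE)
    obtain i0 where i0: "i0 \<in> I" "\<forall>i\<in>I. le i0 i \<longrightarrow> \<bar>x i - l\<bar> \<le> y j"
      using bspec[OF dom j(1)] by (rule bexE)
    have "le i0 i0" using I i0(1) by (simp add: directed_set_def)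
    then have "x i0 \<in> A \<and> \<bar>x i0 - l\<bar> \<le> d" using i0 j x by simp
    then show ?thesis unfolding z_def by (rule someI[of "\<lambda>v. v \<in> A \<and> \<bar>v - l\<bar> \<le> d" "x i0"])
  qed
  have dir: "directed_set (y ` J) (\<lambda>a b. b \<le> a)"
  proof -
    have "J \<noteq> {}" and up: "\<forall>i\<in>J. \<forall>j\<in>J. \<exists>k\<in>J. le' i k \<and> le' j k"
      using J unfolding directed_set_def by blast+
    have "\<exists>k\<in>J. y k \<le> y i \<and> y k \<le> y j" if ij: "i \<in> J" "j \<in> J" for i j
    proof -
      obtain k where k: "k \<in> J" "le' i k \<and> le' j k"
        using bspec[OF bspec[OF up ij(1)] ij(2)] by (rule bexE)
      have mono: "\<forall>i\<in>J. \<forall>j\<in>J. le' i j \<longrightarrow> y j \<le> y i"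
        using y by (simp add: net_decreasing_to_0_def)
      have "y k \<le> y i" "y k \<le> y j"
        using k mono ij by simp_all
      then show ?thesis
        using k(1) by blast
    qed
    then show ?thesis
      using \<open>J \<noteq> {}\<close> unfolding directed_set_def by (auto intro: order_trans)
  qed
  have dec: "net_decreasing_to_0 (y ` J) (\<lambda>a b. b \<le> a) (\<lambda>d. d)"
    using y by (simp add: net_decreasing_to_0_def)
  have "order_convergent (y ` J) (\<lambda>a b. b \<le> a) z l"
    unfolding order_convergent_def
    using dec z by blast
  moreover have "\<forall>d\<in>y ` J. z d \<in> A"
    using z by blast
  ultimately show ?thesis
    using A[unfolded order_closed_def, THEN spec, THEN spec, THEN spec, THEN spec,
        of "y ` J" "\<lambda>a b. b \<le> a" z l] dir
    by blast
qed

text \<open>Sequences are indexed by the positive integers; values at index \<open>0\<close> are ignored, and index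
  sets \<open>K\<close> are required to consist of positive integers.\<close>

definition has_natural_density :: "nat set \<Rightarrow> real \<Rightarrow> bool"
  where "has_natural_density K d \<longleftrightarrow>
     (\<lambda>n. real (card {k. 1 \<le> k \<and> k \<le> n \<and> k \<in> K}) / real n) \<longlonglongrightarrow> d"

definition st_decreasing_to_0 :: "(nat \<Rightarrow> 'b::archimedean_riesz_space) \<Rightarrow> bool"
  where "st_decreasing_to_0 q \<longleftrightarrow>
     (\<exists>K\<subseteq>{1..}. has_natural_density K 1 \<and>
        (\<forall>i\<in>K. \<forall>j\<in>K. i \<le> j \<longrightarrow> q j \<le> q i) \<and> isGlb UNIV (q ` K) 0)"

definition st_up_convergent ::
  "('a::archimedean_riesz_space \<Rightarrow> 'b::archimedean_riesz_space) \<Rightarrow> (nat \<Rightarrow> 'a) \<Rightarrow> 'a \<Rightarrow> bool"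
  where "st_up_convergent p x l \<longleftrightarrow>
     (\<forall>u\<ge>0. \<exists>q. st_decreasing_to_0 q \<and>
        (\<exists>K\<subseteq>{1..}. has_natural_density K 1 \<and> (\<forall>k\<in>K. p (inf \<bar>x k - l\<bar> u) \<le> q k)))"

end

theory Submission
  imports Defs
begin

text \<open>
  The elements \<open>v \<in> B\<close> with \<open>0 \<le> v \<le> \<bar>x\<bar>\<close> form an upward directed set, so by order closedness it is
  enough that their supremum is \<open>\<bar>x\<bar>\<close>. Testing the convergence against \<open>u = \<bar>x\<bar>\<close> shows this: the
  remainders \<open>\<bar>x\<bar> - \<bar>b k\<bar> \<and> \<bar>x\<bar> \<le> \<bar>b k - x\<bar> \<and> \<bar>x\<bar>\<close> have \<open>p\<close>-norm at most \<open>q k\<close> on a set of density 1,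
  so anything positive below all of them has \<open>p\<close>-norm \<open>0\<close>.
\<close>

text \<open>If all common elements were below \<open>m\<close>, inclusion-exclusion would bound the
  two counts up to \<open>n\<close> together by \<open>n + m\<close>. Dividing by \<open>n\<close>,
  the densities would add up to at most 1 instead of 2.\<close>

lemma has_natural_density_one_Int_unbounded:
  assumes K: "has_natural_density K 1" and L: "has_natural_density L 1"
  shows "\<exists>k\<in>K \<inter> L. m \<le> k"
proof (rule ccontr)
  assume none: "\<not> (\<exists>k\<in>K \<inter> L. m \<le> k)"
  define K' where "K' n = {k. 1 \<le> k \<and> k \<le> n \<and> k \<in> K}" for n
  define L' where "L' n = {k. 1 \<le> k \<and> k \<le> n \<and> k \<in> L}" for n
  have card_le: "real (card (K' n)) / real n + real (card (L' n)) / real n \<le> 1 + real m / real n"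
    if "n \<ge> 1" for n
  proof -
    have fin: "finite (K' n)" "finite (L' n)"
      by (rule finite_subset[of _ "{1..n}"]; auto simp: K'_def L'_def)+
    have "card (K' n \<union> L' n) \<le> card {1..n}"
      by (rule card_mono) (auto simp: K'_def L'_def)
    moreover have "card (K' n \<inter> L' n) \<le> card {..<m}"
      using none by (intro card_mono) (auto simp: K'_def L'_def not_le)
    ultimately have "card (K' n) + card (L' n) \<le> n + m"
      using card_Un_Int[OF fin] by simp
    then have "real (card (K' n)) + real (card (L' n)) \<le> real n + real m"
      by (metis of_nat_add of_nat_mono)
    then have "(real (card (K' n)) + real (card (L' n))) / real n \<le> (real n + real m) / real n"
      by (rule divide_right_mono) simp
    then show ?thesis
      using that by (simp add: add_divide_distrib)
  qed
  have "(\<lambda>n. real (card (K' n)) / real n + real (card (L' n)) / real n) \<longlonglongrightarrow> 1 + 1"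
    using K L unfolding has_natural_density_def K'_def L'_def by (rule tendsto_add)
  moreover have "(\<lambda>n. 1 + real m / real n) \<longlonglongrightarrow> 1 + 0"
    by (intro tendsto_add tendsto_const lim_const_over_n)
  ultimately have "(1 + 1 :: real) \<le> 1 + 0"
    by (rule LIMSEQ_le) (use card_le in blast)
  then show False by simp
qed

text \<open>The set \<open>K\<close> on which \<open>q\<close> decreases may differ from
  \<open>L\<close>, but beyond each \<open>i\<close> in \<open>K\<close> there is some
  \<open>k\<close> in both. Then \<open>c \<le> q k \<le> q i\<close>, so \<open>c\<close> bounds
  \<open>q\<close> from below on all of \<open>K\<close>, where the infimum is 0.\<close>

lemma st_decreasing_to_0_lower_bound:
  assumes q: "st_decreasing_to_0 q" and L: "has_natural_density L 1"
    and le: "\<And>k. k \<in> L \<Longrightarrow> c \<le> q k"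
  shows "c \<le> 0"
proof -
  obtain K where K: "has_natural_density K 1"
    and dec: "\<And>i j. i \<in> K \<Longrightarrow> j \<in> K \<Longrightarrow> i \<le> j \<Longrightarrow> q j \<le> q i"
    and glb: "isGlb UNIV (q ` K) 0"
    using q unfolding st_decreasing_to_0_def by blast
  have "c \<le> q i" if "i \<in> K" for i
  proof -
    obtain k where "k \<in> K" "k \<in> L" "i \<le> k"
      using has_natural_density_one_Int_unbounded[OF K L] by blast
    then show ?thesis
      using dec le that order_trans by blast
  qed
  then show ?thesis
    using glb by (auto simp: isGlb_def greatestP_def isLb_def setle_def setge_def)
qed

lemma band_mem_if_approximable:
  assumes B: "band B"
    and approx: "\<And>l. 0 \<le> l \<Longrightarrow> (\<And>v. v \<in> B \<Longrightarrow> 0 \<le> v \<Longrightarrow> v \<le> \<bar>x\<bar> \<Longrightarrow> l \<le> \<bar>x\<bar> - v) \<Longrightarrow> l = 0"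
  shows "x \<in> B"
proof -
  have sub: "subspace B" and closed: "order_closed B"
    and solid: "\<And>v w. w \<in> B \<Longrightarrow> \<bar>v\<bar> \<le> \<bar>w\<bar> \<Longrightarrow> v \<in> B"
    using B unfolding band_def riesz_ideal_def solid_def by blast+
  define V where "V = {v \<in> B. 0 \<le> v \<and> v \<le> \<bar>x\<bar>}"
  \<comment> \<open>The remainders index the net, ordered by reversed \<open>\<le>\<close>:
    \<open>order_closed\<close> takes index sets inside the space, and each remainder can then serve
    as its own error bound.\<close>
  define D where "D = (\<lambda>v. \<bar>x\<bar> - v) ` V"
  have "0 \<in> V"
    using sub by (simp add: V_def subspace_0)
  have sup_V: "sup v w \<in> V" if "v \<in> V" "w \<in> V" for v w
  proof -
    \<comment> \<open>For nonnegative \<open>v\<close> and \<open>w\<close> the supremum is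
      dominated by \<open>v + w\<close>, so solidity puts it in \<open>B\<close>.\<close>
    have "v + w \<in> B" "0 \<le> v" "0 \<le> w"
      using that sub by (auto simp: V_def subspace_add)
    moreover from this have "sup v w \<le> v + w" "0 \<le> sup v w"
      by (simp_all add: le_supI1)
    ultimately have "sup v w \<in> B" "0 \<le> sup v w"
      by (simp_all add: solid[of "v + w"])
    then show ?thesis
      using that by (simp add: V_def)
  qed
  have "\<exists>d\<in>D. d \<le> \<bar>x\<bar> - v \<and> d \<le> \<bar>x\<bar> - w" if "v \<in> V" "w \<in> V" for v w
    unfolding D_def
    by (rule bexI[OF _ imageI[OF sup_V[OF that]]]) (intro conjI diff_left_mono sup_ge1 sup_ge2)
  then have dir: "directed_set D (\<lambda>c d. d \<le> c)"
    using \<open>0 \<in> V\<close> unfolding directed_set_def by (auto simp: D_def)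
  have "isGlb UNIV D 0"
  proof -
    have "l \<le> 0" if l: "\<And>d. d \<in> D \<Longrightarrow> l \<le> d" for l
    proof -
      \<comment> \<open>\<open>approx\<close> speaks of nonnegative lower bounds only;
        \<open>sup l 0\<close> is still one, since all remainders are nonnegative.\<close>
      have "sup l 0 = 0"
        by (rule approx) (use l in \<open>auto simp: D_def V_def\<close>)
      then show ?thesis
        by (metis sup_ge1)
    qed
    then show ?thesis
      by (auto simp: isGlb_def greatestP_def isLb_def setle_def setge_def D_def V_def)
  qed
  \<comment> \<open>The map \<open>\<bar>x\<bar> - d\<close> recovers the element of
    \<open>V\<close> from its remainder \<open>d\<close>, and its distance to
    \<open>\<bar>x\<bar>\<close> is exactly \<open>d\<close>.\<close>
  then have "order_convergent D (\<lambda>c d. d \<le> c) (\<lambda>d. \<bar>x\<bar> - d) \<bar>x\<bar>"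
    unfolding order_convergent_def net_decreasing_to_0_def
    by (intro exI[of _ "\<lambda>d. d"]) (auto simp: D_def V_def)
  moreover have "\<forall>d\<in>D. \<bar>x\<bar> - d \<in> B"
    by (auto simp: D_def V_def)
  ultimately have "\<bar>x\<bar> \<in> B"
    using closed[unfolded order_closed_def, rule_format, of D "\<lambda>c d. d \<le> c" "\<lambda>d. \<bar>x\<bar> - d" "\<bar>x\<bar>"] dir
    by blast
  then show ?thesis
    by (rule solid) simp
qed

theorem proposition4p6:
  fixes p :: "'a::archimedean_riesz_space \<Rightarrow> 'b::archimedean_riesz_space"
    and B :: "'a set" and b :: "nat \<Rightarrow> 'a" and x :: 'a
  assumes "lattice_normed_riesz_space p"
    and "band B"
    and "\<forall>n\<ge>1. b n \<in> B"
    and "st_up_convergent p b x"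
  shows "x \<in> B"
  using \<open>band B\<close>
proof (rule band_mem_if_approximable)
  fix l :: 'a
  assume l: "0 \<le> l" "\<And>v. v \<in> B \<Longrightarrow> 0 \<le> v \<Longrightarrow> v \<le> \<bar>x\<bar> \<Longrightarrow> l \<le> \<bar>x\<bar> - v"
  interpret lattice_normed_riesz_space p by fact
  have solid: "\<And>v w. w \<in> B \<Longrightarrow> \<bar>v\<bar> \<le> \<bar>w\<bar> \<Longrightarrow> v \<in> B"
    using \<open>band B\<close> unfolding band_def riesz_ideal_def solid_def by blast
  obtain q K where q: "st_decreasing_to_0 q" and K: "K \<subseteq> {1..}" "has_natural_density K 1"
    and pq: "\<And>k. k \<in> K \<Longrightarrow> p (inf \<bar>b k - x\<bar> \<bar>x\<bar>) \<le> q k"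
    using \<open>st_up_convergent p b x\<close> abs_ge_zero[of x] unfolding st_up_convergent_def by blast
  have "p l \<le> q k" if "k \<in> K" for k
  proof -
    have "b k \<in> B"
      using assms(3) K(1) that by auto
    \<comment> \<open>This truncation of \<open>\<bar>b k\<bar>\<close> is the element
      \<open>v\<close> at which the bound on \<open>l\<close> is used.\<close>
    then have "inf \<bar>b k\<bar> \<bar>x\<bar> \<in> B"
      by (rule solid) simp
    then have l_le: "l \<le> \<bar>x\<bar> - inf \<bar>b k\<bar> \<bar>x\<bar>"
      by (intro l(2)) auto
    \<comment> \<open>By the reverse triangle inequality. The left side is also at most
      \<open>\<bar>x\<bar>\<close>, hence below the truncation; rearranging bounds the remainder by
      \<open>\<bar>b k - x\<bar>\<close>.\<close>
    have "\<bar>x\<bar> - \<bar>b k - x\<bar> \<le> \<bar>b k\<bar>"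
      using abs_triangle_ineq2[of x "x - b k"] by (simp add: abs_minus_commute)
    then have "\<bar>x\<bar> - \<bar>b k - x\<bar> \<le> inf \<bar>b k\<bar> \<bar>x\<bar>"
      by simp
    then have "\<bar>x\<bar> - inf \<bar>b k\<bar> \<bar>x\<bar> \<le> \<bar>b k - x\<bar>"
      by (simp only: diff_le_eq add.commute)
    moreover have "\<bar>x\<bar> - inf \<bar>b k\<bar> \<bar>x\<bar> \<le> \<bar>x\<bar>"
      by simp
    ultimately have "l \<le> inf \<bar>b k - x\<bar> \<bar>x\<bar>"
      using l_le by (meson le_infI order_trans)
    then have "p l \<le> p (inf \<bar>b k - x\<bar> \<bar>x\<bar>)"
      using l(1) by (intro p_mono) simp
    then show ?thesis
      using pq[OF that] by (rule order_trans)
  qed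
  \<comment> \<open>\<open>p l\<close> does not depend on \<open>k\<close>, so it is a constant
    lower bound of \<open>q\<close> on a set of density 1.\<close>
  then have "p l \<le> 0"
    by (rule st_decreasing_to_0_lower_bound[OF q K(2)])
  then show "l = 0"
    using p_nonneg[of l] p_eq_0_iff[of l] by (simp add: order_antisym)
qed

end
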